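(* Let $n\ge3$ and let $f_1,f_2,f_3$ be three quadratic functions on $\mathbb{R}^n$, $f_i(x)=x^\top A_ix+2b_i^\top x+c_i$, with associated matrices $Q_i=\begin{bmatrix}A_i & b_i\\ b_i^\top & c_i\end{bmatrix}$, such that there exists $\theta\in\mathbb{R}^3$ with $\sum_{i=1}^3\theta_iQ_i\succ0$. Let $S=\{x\in\mathbb{R}^n:f_i(x)<0,\ i=1,2,3\}$ and suppose $S\ne\emptyset$ and $\mathrm{conv}(S)\ne\mathbb{R}^n$. Then there exists $\Omega'\subseteq\Omega$ with $|\Omega'|\le6$ such that $\mathrm{conv}(S)=\bigcap_{\lambda\in\Omega'}S_\lambda$.
   Context: $A_i$ are symmetric real $n\times n$ matrices, $b_i\in\mathbb{R}^n$, $c_i\in\mathbb{R}$. For $\lambda\in\mathbb{R}^3_+$ (nonnegative orthant): $Q_\lambda=\sum_{i=1}^3\lambda_iQ_i$ and $S_\lambda=\{x\in\mathbb{R}^n:\sum_{i=1}^3\lambda_if_i(x)<0\}$. $\Omega=\{\lambda\in\mathbb{R}^3_+\setminus\{0\}: \mathrm{conv}(S)\subseteq S_\lambda$ and $Q_\lambda$ has at most one negative eigenvalue$\}$. *)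

theory Defs
  imports "HOL-Analysis.Analysis" "HOL-Computational_Algebra.Polynomial"
begin

definition quadratic_fun ::
  "real^'n^'n \<Rightarrow> real^'n \<Rightarrow> real \<Rightarrow> real^'n \<Rightarrow> real" where
  "quadratic_fun A b c x = x \<bullet> (A *v x) + 2 * (b \<bullet> x) + c"

text \<open>
  The bordered matrix is indexed by \<^typ>\<open>'n option\<close>, which has one element more than
  \<^typ>\<open>'n\<close>: \<^term>\<open>Some i\<close> is the original coordinate \<open>i\<close> and \<^term>\<open>None\<close> the additional
  (last) one.
\<close>

definition quadratic_matrix ::
  "real^'n^'n \<Rightarrow> real^'n \<Rightarrow> real \<Rightarrow> real^('n option)^('n option)" where
  "quadratic_matrix A b c = (\<chi> i j.
     (case i of
        Some k \<Rightarrow> (case j of Some l \<Rightarrow> A $ k $ l | None \<Rightarrow> b $ k)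
      | None \<Rightarrow> (case j of Some l \<Rightarrow> b $ l | None \<Rightarrow> c)))"

definition positive_definite :: "real^'m^'m \<Rightarrow> bool" where
  "positive_definite M \<longleftrightarrow>
     transpose M = M \<and> (\<forall>x. x \<noteq> 0 \<longrightarrow> 0 < x \<bullet> (M *v x))"

definition charpoly :: "real^'m^'m \<Rightarrow> real poly" where
  "charpoly M = det (\<chi> i j. if i = j then [:- (M $ i $ j), 1:] else [:- (M $ i $ j):])"

text \<open>
  Eigenvalues are counted with multiplicity: \<^const>\<open>proots\<close> is the multiset of roots. It contains
  the real roots only, but a real symmetric matrix has no others.
\<close>

definition num_negative_eigenvalues :: "real^'m^'m \<Rightarrow> nat" where
  "num_negative_eigenvalues M = size (filter_mset (\<lambda>t. t < 0) (proots (charpoly M)))"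

definition aggregated_matrix ::
  "(3 \<Rightarrow> real^'n^'n) \<Rightarrow> (3 \<Rightarrow> real^'n) \<Rightarrow> (3 \<Rightarrow> real) \<Rightarrow> real^3
    \<Rightarrow> real^('n option)^('n option)" where
  "aggregated_matrix A b c \<mu> = (\<Sum>i\<in>UNIV. (\<mu> $ i) *\<^sub>R quadratic_matrix (A i) (b i) (c i))"

definition solution_set ::
  "(3 \<Rightarrow> real^'n^'n) \<Rightarrow> (3 \<Rightarrow> real^'n) \<Rightarrow> (3 \<Rightarrow> real) \<Rightarrow> (real^'n) set" where
  "solution_set A b c = {x. \<forall>i. quadratic_fun (A i) (b i) (c i) x < 0}"

definition aggregated_set ::
  "(3 \<Rightarrow> real^'n^'n) \<Rightarrow> (3 \<Rightarrow> real^'n) \<Rightarrow> (3 \<Rightarrow> real) \<Rightarrow> real^3 \<Rightarrow> (real^'n) set" where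
  "aggregated_set A b c \<mu> =
     {x. (\<Sum>i\<in>UNIV. \<mu> $ i * quadratic_fun (A i) (b i) (c i) x) < 0}"

definition good_aggregations ::
  "(3 \<Rightarrow> real^'n^'n) \<Rightarrow> (3 \<Rightarrow> real^'n) \<Rightarrow> (3 \<Rightarrow> real) \<Rightarrow> (real^3) set" where
  "good_aggregations A b c =
     {\<mu>. (\<forall>i. 0 \<le> \<mu> $ i) \<and> \<mu> \<noteq> 0
        \<and> convex hull (solution_set A b c) \<subseteq> aggregated_set A b c \<mu>
        \<and> num_negative_eigenvalues (aggregated_matrix A b c \<mu>) \<le> 1}"

end

theory Submission
  imports Defs
begin

text \<open>
  Write \<open>x\<close> in homogeneous coordinates as \<open>(x, 1)\<close>, so that the three quadratic functions become
  quadratic forms on a space of dimension \<open>n + 1\<close>; let \<open>q(v)\<close> be the vector of their three values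
  at \<open>v\<close>. For \<open>y\<close> outside \<open>conv S\<close>, a hyperplane through \<open>y\<close> that has \<open>S\<close> on one side becomes a
  linear hyperplane \<open>H\<close>, of dimension at least three, on which the forms are never simultaneously
  negative. The image \<open>q(H)\<close> is a convex cone: this is the hidden convexity of three quadratic
  forms that have a positive definite combination \<open>\<theta>\<close> (\<open>image_closed_under_add\<close>). Separating it
  from the negative orthant yields \<open>\<mu> \<ge> 0\<close>, \<open>\<mu> \<noteq> 0\<close>, such that \<open>\<mu> \<bullet> q\<close> is nonnegative on \<open>H\<close>
  (\<open>nonneg_multiplier\<close>). So \<open>y\<close> violates the aggregated inequality. On the other hand a form that is
  nonnegative on a hyperplane has at most one negative eigenvalue, and the aggregated form is negative
  at the points of \<open>S\<close>, so the cone where it is negative consists of two opposite convex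
  nappes, one on each side of \<open>H\<close>; as \<open>S\<close> lies in one of them, so does its hull.

  Six aggregations are enough because \<open>\<mu>\<close> can be taken on the boundary of the orthant. Adding
  positive multiples of \<open>\<theta>\<close> to \<open>\<mu>\<close> keeps the form nonnegative on \<open>H\<close>, and since \<open>S\<close> is nonempty,
  \<open>\<theta>\<close> has a negative entry, so that the ray \<open>\<mu> + s\<theta>\<close> leaves the orthant through one of its three
  facets (\<open>facet_multiplier\<close>). The multipliers that give valid aggregations form a closed cone, and
  the part of a closed cone in a two-dimensional facet lies between two extreme rays of it
  (\<open>facet_extreme_rays\<close>). If an aggregation excludes \<open>y\<close>, then one of the two extreme ones does.
  Three facets with two rays each make six.
\<close>

section \<open>Hidden convexity of three quadratic forms\<close>

unbundle cross3_syntax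

lemma symmetric_bilinear_expand:
  fixes g :: "'a::euclidean_space \<Rightarrow> 'a \<Rightarrow> 'b::euclidean_space"
  assumes "bilinear g" and "\<And>u v. g u v = g v u"
  shows "g (a *\<^sub>R x + b *\<^sub>R y) (a *\<^sub>R x + b *\<^sub>R y)
       = (a\<^sup>2) *\<^sub>R g x x + (2 * a * b) *\<^sub>R g x y + (b\<^sup>2) *\<^sub>R g y y"
proof -
  have "g (a *\<^sub>R x + b *\<^sub>R y) (a *\<^sub>R x + b *\<^sub>R y)
      = (a*a) *\<^sub>R g x x + (a * b) *\<^sub>R g x y + (a * b) *\<^sub>R g x y + (b*b) *\<^sub>R g y y"
    using assms(2)[of y x]
    by (simp add: bilinear_ladd[OF assms(1)] bilinear_radd[OF assms(1)] bilinear_lmul[OF assms(1)]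
      bilinear_rmul[OF assms(1)] scaleR_add_right mult.commute)
  then show ?thesis
    by (simp add: power2_eq_square scaleR_2[symmetric] mult.assoc)
qed

text \<open>
  From dimension three on, two null vectors of a quadratic form can be joined inside the punctured
  null cone, up to a scalar multiple of the endpoint. If \<open>x\<close> and \<open>y\<close> are orthogonal for the form, the
  segment between them consists of null vectors. Otherwise there is a third vector \<open>z\<close> orthogonal
  to both, and on \<open>a x + b y + c z\<close> the form has the value \<open>2 a b g(x,y) + c\<^sup>2 g(z,z)\<close>, so that null vectors can be written down explicitly.
\<close>
lemma null_path:
  fixes g :: "'a::euclidean_space \<Rightarrow> 'a \<Rightarrow> real"
  assumes g: "bilinear g" and sym: "\<And>u v. g u v = g v u"
    and U: "subspace U" "3 \<le> dim U" and xy: "x \<in> U" "y \<in> U"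
    and indep: "\<And>a b. a *\<^sub>R x + b *\<^sub>R y = 0 \<Longrightarrow> a = 0 \<and> b = 0"
    and null: "g x x = 0" "g y y = 0"
  obtains \<phi> k where "continuous_on {0..1::real} \<phi>" "\<phi> 0 = x" "\<phi> 1 = k *\<^sub>R y" "k \<noteq> 0"
    "\<And>t. t \<in> {0..1} \<Longrightarrow> \<phi> t \<in> U \<and> \<phi> t \<noteq> 0 \<and> g (\<phi> t) (\<phi> t) = 0"
proof (cases "g x y = 0")
  case True
  show ?thesis
  proof (rule that[of "\<lambda>t. (1 - t) *\<^sub>R x + t *\<^sub>R y" 1])
    fix t :: real
    have "(1 - t) *\<^sub>R x + t *\<^sub>R y \<noteq> 0" using indep[of "1-t" t] by auto
    then show "(1 - t) *\<^sub>R x + t *\<^sub>R y \<in> U \<and> (1 - t) *\<^sub>R x + t *\<^sub>R y \<noteq> 0 \<and>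
      g ((1 - t) *\<^sub>R x + t *\<^sub>R y) ((1 - t) *\<^sub>R x + t *\<^sub>R y) = 0"
      using U(1) xy True null
      by (simp add: symmetric_bilinear_expand[OF g sym] subspace_add subspace_scale)
  qed (auto intro!: continuous_intros)
next
  case False
  have "\<not> U \<subseteq> span {x, y}"
  proof
    assume "U \<subseteq> span {x, y}"
    then have "dim U \<le> card {x, y}" using dim_le_card[of U "{x,y}"] by simp
    moreover have "card {x, y} \<le> 2" by (simp add: card_insert_if)
    ultimately show False using U(2) by simp
  qed
  then obtain z0 where z0: "z0 \<in> U" "z0 \<notin> span {x, y}" by blast
  \<comment> \<open>The plane spanned by \<open>x\<close> and \<open>y\<close> is nondegenerate, so \<open>z0\<close> has a component orthogonal to it.\<close>
  define z where "z = z0 - ((g z0 y / g x y) *\<^sub>R x + (g z0 x / g x y) *\<^sub>R y)"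
  have comb: "a *\<^sub>R x + b *\<^sub>R y \<in> span {x, y}" for a b
    by (simp add: span_add span_base span_scale)
  have zU: "z \<in> U" unfolding z_def using U(1) xy z0(1)
    by (intro subspace_diff subspace_add subspace_scale) auto
  have zspan: "z \<notin> span {x, y}"
    using span_add[OF _ comb, of z "g z0 y / g x y" "g z0 x / g x y"] z0(2) unfolding z_def by auto
  have gzx: "g x z = 0" and gzy: "g y z = 0"
    unfolding z_def using False null sym[of y x] sym[of z0]
    by (simp_all add: bilinear_rsub[OF g] bilinear_radd[OF g] bilinear_rmul[OF g])
  have val: "g (a *\<^sub>R x + b *\<^sub>R y + c *\<^sub>R z) (a *\<^sub>R x + b *\<^sub>R y + c *\<^sub>R z)
      = 2 * a * b * g x y + c\<^sup>2 * g z z" for a b c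
    using symmetric_bilinear_expand[OF g sym, of 1 "a *\<^sub>R x + b *\<^sub>R y" c z]
      symmetric_bilinear_expand[OF g sym, of a x b y] null gzx gzy
    by (simp add: bilinear_ladd[OF g] bilinear_lmul[OF g])
  have nz: "a = 0 \<and> b = 0 \<and> c = 0" if "a *\<^sub>R x + b *\<^sub>R y + c *\<^sub>R z = 0" for a b c
  proof -
    have "c = 0"
    proof (rule ccontr)
      assume c: "c \<noteq> 0"
      have "c *\<^sub>R z = - (a *\<^sub>R x + b *\<^sub>R y)" using that by (metis add_eq_0_iff)
      then have "c *\<^sub>R z \<in> span {x, y}" using comb[of a b] span_neg by metis
      then have "(1/c) *\<^sub>R (c *\<^sub>R z) \<in> span {x, y}" by (rule span_scale)
      then show False using c zspan by simp
    qed
    then show ?thesis using that indep[of a b] by simp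
  qed
  have inU: "a *\<^sub>R x + b *\<^sub>R y + c *\<^sub>R z \<in> U" for a b c
    using U(1) xy zU by (intro subspace_add subspace_scale) auto
  show ?thesis
  proof (cases "g z z = 0")
    case True
    \<comment> \<open>Here \<open>z\<close> is null as well: go from \<open>x\<close> to a multiple of \<open>z\<close> and on to \<open>y\<close>; one of the first two
      coefficients vanishes all the time.\<close>
    show ?thesis
    proof (rule that[of "\<lambda>t. max 0 (1 - 2*t) *\<^sub>R x + max 0 (2*t - 1) *\<^sub>R y + (t * (1 - t)) *\<^sub>R z" 1])
      fix t :: real assume "t \<in> {0..1}"
      have "max 0 (1 - 2*t) *\<^sub>R x + max 0 (2*t - 1) *\<^sub>R y + (t * (1 - t)) *\<^sub>R z \<noteq> 0"
      proof
        assume "max 0 (1 - 2*t) *\<^sub>R x + max 0 (2*t - 1) *\<^sub>R y + (t * (1 - t)) *\<^sub>R z = 0"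
        from nz[OF this] have "max 0 (1 - 2*t) = 0" "max 0 (2*t - 1) = 0" "t * (1-t) = 0" by auto
        then show False by (auto simp: max_def split: if_splits)
      qed
      moreover have "max 0 (1 - 2*t) * max 0 (2*t - 1) = 0" by (simp add: max_def)
      ultimately show "max 0 (1 - 2*t) *\<^sub>R x + max 0 (2*t - 1) *\<^sub>R y + (t * (1 - t)) *\<^sub>R z \<in> U \<and>
         max 0 (1 - 2*t) *\<^sub>R x + max 0 (2*t - 1) *\<^sub>R y + (t * (1 - t)) *\<^sub>R z \<noteq> 0 \<and>
         g (max 0 (1 - 2*t) *\<^sub>R x + max 0 (2*t - 1) *\<^sub>R y + (t * (1 - t)) *\<^sub>R z)
           (max 0 (1 - 2*t) *\<^sub>R x + max 0 (2*t - 1) *\<^sub>R y + (t * (1 - t)) *\<^sub>R z) = 0"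
        using True inU by (simp add: val)
    qed (auto intro!: continuous_intros)
  next
    case gz: False
    \<comment> \<open>This \<open>k\<close> solves \<open>2 a b g(x,y) + c\<^sup>2 g(z,z) = 0\<close> for \<open>a = (1 - t)\<^sup>2\<close>, \<open>b = k t\<^sup>2\<close>, \<open>c = t (1 - t)\<close>.\<close>
    define k where "k = - g z z / (2 * g x y)"
    have k: "k \<noteq> 0" "2 * k * g x y = - g z z" using gz False by (auto simp: k_def)
    show ?thesis
    proof (rule that[of "\<lambda>t. ((1 - t)\<^sup>2) *\<^sub>R x + (k * t\<^sup>2) *\<^sub>R y + (t * (1 - t)) *\<^sub>R z" k])
      fix t :: real assume "t \<in> {0..1}"
      have "((1 - t)\<^sup>2) *\<^sub>R x + (k * t\<^sup>2) *\<^sub>R y + (t * (1 - t)) *\<^sub>R z \<noteq> 0"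
      proof
        assume "((1 - t)\<^sup>2) *\<^sub>R x + (k * t\<^sup>2) *\<^sub>R y + (t * (1 - t)) *\<^sub>R z = 0"
        from nz[OF this] k show False by auto
      qed
      moreover have "2 * (1 - t)\<^sup>2 * (k * t\<^sup>2) * g x y + (t * (1 - t))\<^sup>2 * g z z = 0"
      proof -
        have "2 * (1 - t)\<^sup>2 * (k * t\<^sup>2) * g x y + (t * (1 - t))\<^sup>2 * g z z
          = (t * (1-t))\<^sup>2 * (2 * k * g x y + g z z)"
          by (simp add: algebra_simps power2_eq_square)
        then show ?thesis using k(2) by simp
      qed
      ultimately show "((1 - t)\<^sup>2) *\<^sub>R x + (k * t\<^sup>2) *\<^sub>R y + (t * (1 - t)) *\<^sub>R z \<in> U \<and>
         ((1 - t)\<^sup>2) *\<^sub>R x + (k * t\<^sup>2) *\<^sub>R y + (t * (1 - t)) *\<^sub>R z \<noteq> 0 \<and>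
         g (((1 - t)\<^sup>2) *\<^sub>R x + (k * t\<^sup>2) *\<^sub>R y + (t * (1 - t)) *\<^sub>R z)
           (((1 - t)\<^sup>2) *\<^sub>R x + (k * t\<^sup>2) *\<^sub>R y + (t * (1 - t)) *\<^sub>R z) = 0"
        using inU by (simp add: val)
    qed (use k in \<open>auto intro!: continuous_intros\<close>)
  qed
qed

lemma bilinear_inner_right:
  fixes B :: "'a::euclidean_space \<Rightarrow> 'a \<Rightarrow> 'b::euclidean_space"
  assumes "bilinear B"
  shows "bilinear (\<lambda>u v. \<mu> \<bullet> B u v)"
  using assms unfolding bilinear_def
  by (auto simp: linear_iff inner_add_right)

lemma parallel_if_cross_eq_0:
  fixes \<theta> u w :: "real^3"
  assumes "u \<times> w = 0" and "\<theta> \<bullet> w \<noteq> 0"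
  shows "u = ((\<theta> \<bullet> u) / (\<theta> \<bullet> w)) *\<^sub>R w"
proof -
  have "\<theta> \<times> (u \<times> w) = (\<theta> \<bullet> w) *\<^sub>R u - (\<theta> \<bullet> u) *\<^sub>R w" by (rule Lagrange)
  then have "(\<theta> \<bullet> w) *\<^sub>R u = (\<theta> \<bullet> u) *\<^sub>R w" using assms(1) by simp
  then have "(1/(\<theta> \<bullet> w)) *\<^sub>R (\<theta> \<bullet> w) *\<^sub>R u = (1/(\<theta> \<bullet> w)) *\<^sub>R (\<theta> \<bullet> u) *\<^sub>R w" by simp
  then show ?thesis using assms(2) by simp
qed

text \<open>
  Hidden convexity of three quadratic forms with a positive definite combination. Let \<open>p\<close> and \<open>r\<close>
  be the two image points and \<open>l = p \<times> r\<close> the normal of the plane that they span. Then \<open>x\<close> and \<open>y\<close> are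
  null vectors of the form \<open>l \<bullet> B\<close>, and along a path of null vectors between them the image stays in
  that plane. It starts and ends on opposite sides of the line through \<open>p + r\<close>, hence meets that
  line, and positivity of \<open>\<theta>\<close> puts the intersection point on the right half of the line.
\<close>
lemma image_closed_under_add:
  fixes B :: "'a::euclidean_space \<Rightarrow> 'a \<Rightarrow> real^3"
  assumes B: "bilinear B" and sym: "\<And>u v. B u v = B v u"
    and U: "subspace U" "3 \<le> dim U"
    and pos: "\<And>v. v \<in> U \<Longrightarrow> v \<noteq> 0 \<Longrightarrow> 0 < \<theta> \<bullet> B v v"
    and xy: "x \<in> U" "y \<in> U"
  shows "\<exists>w\<in>U. B w w = B x x + B y y"
proof -
  define p where "p = B x x"
  define r where "r = B y y"
  have scale: "B (c *\<^sub>R v) (c *\<^sub>R v) = c\<^sup>2 *\<^sub>R B v v" for c v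
    by (simp add: bilinear_lmul[OF B] bilinear_rmul[OF B] power2_eq_square)
  have target: "\<exists>w\<in>U. B w w = s *\<^sub>R B v v" if "v \<in> U" "0 \<le> s" for v s
    using that U(1) by (intro bexI[of _ "sqrt s *\<^sub>R v"]) (auto simp: scale subspace_scale)
  have B0: "B 0 v = 0" for v by (rule bilinear_lzero[OF B])
  consider "x = 0" | "y = 0" | "x \<noteq> 0" "y \<noteq> 0" "p \<times> r = 0" | "x \<noteq> 0" "y \<noteq> 0" "p \<times> r \<noteq> 0" by blast
  then show ?thesis
  proof cases
    case 1 then show ?thesis using xy by (auto simp: B0)
  next
    case 2 then show ?thesis using xy by (auto simp: B0)
  next
    case 3
    have pr: "0 < \<theta> \<bullet> p" "0 < \<theta> \<bullet> r" using pos xy 3 by (auto simp: p_def r_def)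
    have "p = ((\<theta> \<bullet> p) / (\<theta> \<bullet> r)) *\<^sub>R r" using 3 pr by (intro parallel_if_cross_eq_0) auto
    then have "p + r = ((\<theta> \<bullet> p) / (\<theta> \<bullet> r) + 1) *\<^sub>R r" by (simp add: scaleR_add_left)
    then show ?thesis using target[OF xy(2), of "(\<theta> \<bullet> p) / (\<theta> \<bullet> r) + 1"] pr by (simp add: p_def r_def)
  next
    case 4
    have pr: "0 < \<theta> \<bullet> p" "0 < \<theta> \<bullet> r" using pos xy 4 by (auto simp: p_def r_def)
    define l where "l = p \<times> r"
    \<comment> \<open>Within the plane of \<open>p\<close> and \<open>r\<close>, the sign of the product with \<open>k\<close> tells the two sides of the
      line through \<open>p + r\<close> apart.\<close>
    define k where "k = l \<times> (p + r)"
    have l0: "l \<noteq> 0" using 4 by (simp add: l_def)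
    have lp: "l \<bullet> p = 0" "l \<bullet> r = 0" by (auto simp: l_def dot_cross_self)
    have kp: "k \<bullet> p = - (l \<bullet> l)" "k \<bullet> r = l \<bullet> l"
      unfolding k_def l_def by (auto simp: cross3_simps)
    have ll: "0 < l \<bullet> l" using l0 by simp
    have indep: "a = 0 \<and> b = 0" if ab: "a *\<^sub>R x + b *\<^sub>R y = 0" for a b
    proof (cases "a = 0")
      case True then show ?thesis using ab 4 by simp
    next
      case False
      have "a *\<^sub>R x = (- b) *\<^sub>R y" using ab by (simp add: eq_neg_iff_add_eq_0)
      then have "(1/a) *\<^sub>R a *\<^sub>R x = (1/a) *\<^sub>R (- b) *\<^sub>R y" by simp
      then have "x = (- b / a) *\<^sub>R y" using False by simp
      then have "p = (- b / a)\<^sup>2 *\<^sub>R r" unfolding p_def r_def by (metis scale)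
      then show ?thesis using 4(3) by (simp add: cross_mult_left)
    qed
    obtain \<phi> c where \<phi>: "continuous_on {0..1::real} \<phi>" "\<phi> 0 = x" "\<phi> 1 = c *\<^sub>R y" "c \<noteq> 0"
      "\<And>t. t \<in> {0..1} \<Longrightarrow> \<phi> t \<in> U \<and> \<phi> t \<noteq> 0 \<and> l \<bullet> B (\<phi> t) (\<phi> t) = 0"
      using null_path[OF bilinear_inner_right[OF B, of l] _ U xy indep] sym lp
      unfolding p_def r_def by (metis (no_types, lifting))
    define h where "h = (\<lambda>t. k \<bullet> B (\<phi> t) (\<phi> t))"
    have "continuous_on {0..1} h" unfolding h_def
      by (intro continuous_intros bilinear_continuous_on_compose[OF _ _ B] \<phi>(1))
    moreover have "h 0 \<le> 0" using kp ll by (simp add: h_def \<phi> p_def[symmetric])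
    moreover have "0 \<le> h 1" using kp ll by (simp add: h_def \<phi> r_def[symmetric] scale)
    ultimately obtain t where t: "0 \<le> t" "t \<le> 1" "h t = 0"
      using IVT'[of h 0 0 1] by auto
    define u where "u = B (\<phi> t) (\<phi> t)"
    have \<phi>t: "\<phi> t \<in> U" "\<phi> t \<noteq> 0" "l \<bullet> u = 0" using \<phi>(5)[of t] t by (auto simp: u_def)
    have ku: "k \<bullet> u = 0" using t by (simp add: h_def u_def)
    have "l \<times> (u \<times> (p + r)) = 0" using \<phi>t(3) lp by (simp add: Lagrange inner_add_right)
    moreover have "l \<bullet> (u \<times> (p + r)) = - (k \<bullet> u)" unfolding k_def by (simp add: cross3_simps)
    ultimately have cr: "u \<times> (p + r) = 0" using ku l0 norm_and_cross_eq_0[of l "u \<times> (p+r)"] by auto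
    have thu: "0 < \<theta> \<bullet> u" using pos \<phi>t by (simp add: u_def)
    have thpr: "0 < \<theta> \<bullet> (p + r)" using pr by (simp add: inner_add_right)
    have "(p + r) \<times> u = 0" using cr cross_skew[of "p+r" u] by simp
    then have "p + r = ((\<theta> \<bullet> (p + r)) / (\<theta> \<bullet> u)) *\<^sub>R u"
      using thu by (intro parallel_if_cross_eq_0) auto
    then show ?thesis using target[OF \<phi>t(1), of "(\<theta> \<bullet> (p + r)) / (\<theta> \<bullet> u)"] thu thpr
      unfolding u_def p_def r_def by (metis divide_nonneg_pos less_eq_real_def)
  qed
qed

unbundle no cross3_syntax

section \<open>Multipliers on the facets of the orthant\<close>

text \<open>
  An S-lemma for three forms: the image of \<open>U\<close> is a convex cone by hidden convexity, so that it can
  be separated from the open negative orthant.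
\<close>
lemma nonneg_multiplier:
  fixes B :: "'a::euclidean_space \<Rightarrow> 'a \<Rightarrow> real^3"
  assumes B: "bilinear B" and sym: "\<And>u v. B u v = B v u"
    and U: "subspace U" "3 \<le> dim U"
    and pos: "\<And>v. v \<in> U \<Longrightarrow> v \<noteq> 0 \<Longrightarrow> 0 < \<theta> \<bullet> B v v"
    and no: "\<And>v. v \<in> U \<Longrightarrow> \<exists>i. 0 \<le> B v v $ i"
  obtains \<mu> where "\<And>i. 0 \<le> \<mu> $ i" "\<mu> \<noteq> 0" "\<And>v. v \<in> U \<Longrightarrow> 0 \<le> \<mu> \<bullet> B v v"
proof -
  define K where "K = (\<lambda>v. B v v) ` U"
  define N where "N = {u :: real^3. \<forall>i. u $ i < 0}"
  have scale: "B (c *\<^sub>R v) (c *\<^sub>R v) = c\<^sup>2 *\<^sub>R B v v" for c v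
    by (simp add: bilinear_lmul[OF B] bilinear_rmul[OF B] power2_eq_square)
  have Kscale: "s *\<^sub>R k \<in> K" if "k \<in> K" "0 \<le> s" for s k
  proof -
    obtain v where v: "v \<in> U" "k = B v v" using \<open>k \<in> K\<close> by (auto simp: K_def)
    have "s *\<^sub>R k = B (sqrt s *\<^sub>R v) (sqrt s *\<^sub>R v)" using v that by (simp add: scale)
    then show ?thesis using v U(1) by (auto simp: K_def subspace_scale)
  qed
  have Kadd: "k + l \<in> K" if "k \<in> K" "l \<in> K" for k l
  proof -
    obtain v w where vw: "v \<in> U" "w \<in> U" "k = B v v" "l = B w w"
      using \<open>k \<in> K\<close> \<open>l \<in> K\<close> by (auto simp: K_def)
    obtain u where u: "u \<in> U" "B u u = B v v + B w w"
      using image_closed_under_add[OF B sym U pos vw(1,2)] by auto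
    then have "k + l = B u u" using vw by simp
    then show ?thesis using u(1) unfolding K_def by blast
  qed
  have K: "convex K" unfolding convex_def using Kscale Kadd by blast
  have N: "convex N"
  proof -
    have "N = (\<Inter>i. {u. axis i 1 \<bullet> u < 0})" by (auto simp: N_def inner_axis')
    then show ?thesis by (simp add: convex_INT convex_halfspace_lt)
  qed
  have "B v v \<notin> N" if "v \<in> U" for v
    using no[OF that] by (auto simp: N_def not_less)
  then have "N \<inter> K = {}" by (auto simp: K_def)
  moreover have z: "0 \<in> K" unfolding K_def
    using bilinear_lzero[OF B, of 0] subspace_0[OF U(1)] by (intro image_eqI[of _ _ 0]) auto
  then have "K \<noteq> {}" by auto
  moreover have "(\<chi> i. - 1) \<in> N" by (simp add: N_def)
  then have "N \<noteq> {}" by auto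
  ultimately obtain \<mu> \<beta> where sep: "\<mu> \<noteq> 0" "\<forall>u\<in>N. \<mu> \<bullet> u \<le> \<beta>" "\<forall>k\<in>K. \<mu> \<bullet> k \<ge> \<beta>"
    using separating_hyperplane_sets[OF N K] by blast
  then have \<mu>: "\<mu> \<noteq> 0" "\<And>u. u \<in> N \<Longrightarrow> \<mu> \<bullet> u \<le> \<beta>" "\<And>k. k \<in> K \<Longrightarrow> \<beta> \<le> \<mu> \<bullet> k"
    by auto
  have \<beta>: "\<beta> \<le> 0" using \<mu>(3)[OF z] by simp
  have coord: "0 \<le> \<mu> $ i" for i
  proof (rule field_le_epsilon)
    fix e :: real assume e: "0 < e"
    define \<epsilon> where "\<epsilon> = e / (1 + \<bar>\<Sum>j\<in>UNIV. \<mu> $ j\<bar>)"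
    have \<epsilon>: "0 < \<epsilon>" using e by (simp add: \<epsilon>_def add_pos_nonneg)
    \<comment> \<open>The vector \<open>- axis i 1\<close> lies only in the closure of \<open>N\<close>.\<close>
    have "- axis i 1 - (\<chi> j. \<epsilon>) \<in> N" using \<epsilon> by (auto simp: N_def axis_def)
    from \<mu>(2)[OF this] \<beta> have "\<mu> \<bullet> (- axis i 1 - (\<chi> j. \<epsilon>)) \<le> 0" by linarith
    then have "- \<mu> $ i \<le> \<epsilon> * (\<Sum>j\<in>UNIV. \<mu> $ j)"
      by (simp add: inner_diff_right inner_axis inner_vec_def[of _ "vec_lambda _"] sum_distrib_left mult.commute)
    also have "\<dots> \<le> \<epsilon> * (1 + \<bar>\<Sum>j\<in>UNIV. \<mu> $ j\<bar>)" using \<epsilon> by (intro mult_left_mono) auto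
    also have "\<dots> = e" by (simp add: \<epsilon>_def)
    finally show "0 \<le> \<mu> $ i + e" by simp
  qed
  have nonneg: "0 \<le> \<mu> \<bullet> B v v" if v: "v \<in> U" for v
  proof (rule ccontr)
    assume *: "\<not> 0 \<le> \<mu> \<bullet> B v v"
    \<comment> \<open>Chosen such that \<open>\<mu> \<bullet> (s B(v,v)) = \<beta> - 1\<close>.\<close>
    define s where "s = (1 - \<beta>) / - (\<mu> \<bullet> B v v)"
    have "0 \<le> s" using * \<beta> by (simp add: s_def divide_nonneg_neg)
    then have "\<beta> \<le> \<mu> \<bullet> (s *\<^sub>R B v v)" using v by (intro \<mu>(3) Kscale) (auto simp: K_def)
    then show False using * by (simp add: s_def)
  qed
  show ?thesis by (rule that[OF coord \<mu>(1) nonneg])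
qed

lemma exit_orthant:
  fixes \<mu> \<theta> :: "real^'k"
  assumes \<mu>: "\<And>i. 0 \<le> \<mu> $ i" and \<theta>: "\<theta> $ i0 < 0"
  obtains s i where "0 \<le> s" "\<And>j. 0 \<le> (\<mu> + s *\<^sub>R \<theta>) $ j" "(\<mu> + s *\<^sub>R \<theta>) $ i = 0"
proof -
  define r where "r = (\<lambda>j. \<mu> $ j / - (\<theta> $ j))"
  define I where "I = {j. \<theta> $ j < 0}"
  define s where "s = Min (r ` I)"
  have I: "finite (r ` I)" "r ` I \<noteq> {}" using \<theta> by (auto simp: I_def)
  obtain i where i: "i \<in> I" "s = r i" using Min_in[OF I] by (auto simp: s_def)
  have s: "0 \<le> s" using i \<mu>[of i] by (simp add: r_def I_def divide_nonneg_neg)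
  show ?thesis
  proof (rule that[of s i])
    show "0 \<le> (\<mu> + s *\<^sub>R \<theta>) $ j" for j
    proof (cases "\<theta> $ j < 0")
      case True
      then have "s \<le> r j" unfolding s_def using I by (intro Min_le) (auto simp: I_def)
      then have "s * - (\<theta> $ j) \<le> \<mu> $ j" using True by (simp add: r_def pos_le_divide_eq field_simps)
      then show ?thesis by simp
    next
      case False then show ?thesis using \<mu>[of j] s by simp
    qed
    show "(\<mu> + s *\<^sub>R \<theta>) $ i = 0" using i by (simp add: r_def I_def)
  qed (rule s)
qed

text \<open>
  Since \<open>\<theta>\<close> is positive on \<open>U\<close>, a multiplier can be moved in the direction \<open>\<theta>\<close> until it reaches the
  boundary of the orthant. It does not arrive at \<open>0\<close>: otherwise it would be a negative multiple of
  \<open>\<theta>\<close>, which is negative on \<open>U\<close>.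
\<close>
lemma facet_multiplier:
  fixes B :: "'a::euclidean_space \<Rightarrow> 'a \<Rightarrow> real^3"
  assumes B: "bilinear B" and sym: "\<And>u v. B u v = B v u"
    and U: "subspace U" "3 \<le> dim U"
    and pos: "\<And>v. v \<in> U \<Longrightarrow> v \<noteq> 0 \<Longrightarrow> 0 < \<theta> \<bullet> B v v"
    and no: "\<And>v. v \<in> U \<Longrightarrow> \<exists>i. 0 \<le> B v v $ i"
    and \<theta>: "\<theta> $ i0 < 0"
  obtains \<mu> i where "\<And>i. 0 \<le> \<mu> $ i" "\<mu> \<noteq> 0" "\<mu> $ i = 0" "\<And>v. v \<in> U \<Longrightarrow> 0 \<le> \<mu> \<bullet> B v v"
proof -
  obtain \<mu> where \<mu>: "\<And>i. 0 \<le> \<mu> $ i" "\<mu> \<noteq> 0" "\<And>v. v \<in> U \<Longrightarrow> 0 \<le> \<mu> \<bullet> B v v"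
    using nonneg_multiplier[OF B sym U pos no] by metis
  obtain s i where s: "0 \<le> s" "\<And>j. 0 \<le> (\<mu> + s *\<^sub>R \<theta>) $ j" "(\<mu> + s *\<^sub>R \<theta>) $ i = 0"
    using exit_orthant[of \<mu> \<theta> i0] \<mu>(1) \<theta> by metis
  have "\<not> U \<subseteq> {0}"
  proof
    assume "U \<subseteq> {0}"
    then have "dim U = 0" by simp
    then show False using U(2) by linarith
  qed
  then obtain v where v: "v \<in> U" "v \<noteq> 0" by auto
  have "\<mu> + s *\<^sub>R \<theta> \<noteq> 0"
  proof
    assume *: "\<mu> + s *\<^sub>R \<theta> = 0"
    then have "\<mu> \<bullet> B v v + s * (\<theta> \<bullet> B v v) = 0"
      by (metis inner_add_left inner_scaleR_left inner_zero_left)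
    then have "s = 0" using \<mu>(3)[OF v(1)] pos[OF v] s(1)
      by (smt (verit) mult_pos_pos)
    then show False using * \<mu>(2) by simp
  qed
  moreover have "0 \<le> (\<mu> + s *\<^sub>R \<theta>) \<bullet> B u u" if "u \<in> U" for u
  proof (cases "u = 0")
    case True then show ?thesis by (simp add: bilinear_lzero[OF B])
  next
    case False then show ?thesis using pos[OF that] \<mu>(3)[OF that] s(1) by (simp add: inner_add_left)
  qed
  ultimately show ?thesis using s(2,3) by (intro that[of "\<mu> + s *\<^sub>R \<theta>" i]) auto
qed

text \<open>
  On the facet \<open>\<mu> $ i = 0\<close> the rays are parametrized by a segment, and the ones that belong to \<open>C\<close> by
  a compact subset of it. The least and the greatest parameter suffice, since \<open>\<mu> \<bullet> w\<close> is affine in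
  the parameter and therefore largest at an end. When \<open>C\<close> misses the facet, \<open>E\<close> is empty.
\<close>
lemma facet_extreme_rays:
  fixes C :: "(real^3) set"
  assumes closed: "closed C" and cone: "\<And>\<mu> s. \<mu> \<in> C \<Longrightarrow> 0 < s \<Longrightarrow> s *\<^sub>R \<mu> \<in> C"
    and nonneg: "\<And>\<mu> j. \<mu> \<in> C \<Longrightarrow> 0 \<le> \<mu> $ j"
  obtains E where "finite E" "card E \<le> 2" "E \<subseteq> C - {0}"
    "\<And>\<mu> w. \<mu> \<in> C \<Longrightarrow> \<mu> \<noteq> 0 \<Longrightarrow> \<mu> $ i = 0 \<Longrightarrow> 0 \<le> \<mu> \<bullet> w \<Longrightarrow> \<exists>\<nu>\<in>E. 0 \<le> \<nu> \<bullet> w"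
proof -
  obtain j k :: 3 where jk: "j \<noteq> k" "i \<noteq> j" "i \<noteq> k" "\<And>l. l = i \<or> l = j \<or> l = k"
  proof -
    consider "i = 1" | "i = 2" | "i = 3" using exhaust_3[of i] by blast
    then show ?thesis
    proof cases
      case 1 show ?thesis by (rule that[of 2 3]) (use 1 exhaust_3 in auto)
    next
      case 2 show ?thesis by (rule that[of 1 3]) (use 2 exhaust_3 in auto)
    next
      case 3 show ?thesis by (rule that[of 1 2]) (use 3 exhaust_3 in auto)
    qed
  qed
  define p where "p = (\<lambda>t::real. t *\<^sub>R axis j (1::real) + (1 - t) *\<^sub>R axis k 1 :: real^3)"
  have p0: "p t \<noteq> 0" for t
  proof
    assume "p t = 0"
    then have "p t $ j = 0" "p t $ k = 0" by simp_all
    then show False using jk by (simp add: p_def axis_def)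
  qed
  define K where "K = {t \<in> {0..1}. p t \<in> C}"
  have "continuous_on UNIV p" unfolding p_def by (intro continuous_intros)
  then have "closed (p -` C)" using closed by (simp add: continuous_on_closed_vimage)
  moreover have "K = {0..1} \<inter> p -` C" by (auto simp: K_def)
  ultimately have K: "compact K" by (simp add: compact_Int_closed)
  have normal: "\<exists>t\<in>K. \<exists>s>0. \<mu> = s *\<^sub>R p t" if \<mu>: "\<mu> \<in> C" "\<mu> \<noteq> 0" "\<mu> $ i = 0" for \<mu>
  proof -
    define s where "s = \<mu> $ j + \<mu> $ k"
    have s: "0 < s"
    proof (rule ccontr)
      assume "\<not> 0 < s"
      then have "\<mu> $ j = 0" "\<mu> $ k = 0" using nonneg[OF \<mu>(1), of j] nonneg[OF \<mu>(1), of k] by (auto simp: s_def)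
      then have "\<mu> = 0" using \<mu>(3) jk(4) unfolding vec_eq_iff by (metis zero_index)
      then show False using \<mu>(2) by simp
    qed
    define t where "t = \<mu> $ j / s"
    have t: "s * t = \<mu> $ j" "s * (1 - t) = \<mu> $ k" "0 \<le> t" "t \<le> 1"
      using s nonneg[OF \<mu>(1), of j] nonneg[OF \<mu>(1), of k]
      by (auto simp: t_def s_def field_simps)
    have eq: "\<mu> = s *\<^sub>R p t"
    proof -
      have "\<mu> $ l = (s *\<^sub>R p t) $ l" for l
        using jk(4)[of l] jk(1-3) \<mu>(3) t(1,2) by (auto simp: p_def axis_def)
      then show ?thesis by (simp add: vec_eq_iff)
    qed
    then have "p t = (1 / s) *\<^sub>R \<mu>" using s by simp
    then have "p t \<in> C" using cone[OF \<mu>(1), of "1/s"] s by simp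
    then show ?thesis using t eq s by (auto simp: K_def)
  qed
  show ?thesis
  proof (cases "K = {}")
    case True
    show ?thesis by (rule that[of "{}"]) (use normal True in auto)
  next
    case False
    obtain a where a: "a \<in> K" "\<And>t. t \<in> K \<Longrightarrow> a \<le> t"
      using compact_attains_inf[OF K False] by blast
    obtain b where b: "b \<in> K" "\<And>t. t \<in> K \<Longrightarrow> t \<le> b"
      using compact_attains_sup[OF K False] by blast
    show ?thesis
    proof (rule that[of "{p a, p b}"])
      fix \<mu> w assume \<mu>: "\<mu> \<in> C" "\<mu> \<noteq> 0" "\<mu> $ i = 0" and w: "0 \<le> \<mu> \<bullet> w"
      obtain t s where t: "t \<in> K" "0 < s" "\<mu> = s *\<^sub>R p t" using normal[OF \<mu>] by blast
      have val: "p r \<bullet> w = w $ k + r * (w $ j - w $ k)" for r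
        by (simp add: p_def inner_add_left inner_axis' algebra_simps)
      have "0 \<le> p t \<bullet> w" using w t by (simp add: zero_le_mult_iff)
      moreover have "p t \<bullet> w \<le> p a \<bullet> w \<or> p t \<bullet> w \<le> p b \<bullet> w"
        unfolding val using a(2)[OF t(1)] b(2)[OF t(1)]
        by (cases "0 \<le> w $ j - w $ k") (auto intro: mult_right_mono mult_right_mono_neg)
      ultimately show "\<exists>\<nu>\<in>{p a, p b}. 0 \<le> \<nu> \<bullet> w" by auto
    qed (use a b p0 in \<open>auto simp: K_def card_insert_if\<close>)
  qed
qed

section \<open>Forms that are nonnegative on a hyperplane\<close>

text \<open>
  The Gram determinant of \<open>v\<close> and \<open>z\<close> does not change when a multiple of \<open>z\<close> is added to \<open>v\<close>, so
  \<open>v\<close> may be moved into the hyperplane.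
\<close>
lemma reverse_cauchy_schwarz:
  fixes g :: "'a::euclidean_space \<Rightarrow> 'a \<Rightarrow> real"
  assumes g: "bilinear g" and sym: "\<And>u v. g u v = g v u"
    and psd: "\<And>v. h \<bullet> v = 0 \<Longrightarrow> 0 \<le> g v v" and neg: "g z z < 0"
  shows "g v v * g z z \<le> (g v z)\<^sup>2"
proof -
  have hz: "h \<bullet> z \<noteq> 0" using psd[of z] neg by auto
  define c where "c = - (h \<bullet> v) / (h \<bullet> z)"
  have "h \<bullet> (1 *\<^sub>R v + c *\<^sub>R z) = 0" using hz by (simp add: inner_add_right inner_diff_right c_def)
  from psd[OF this] have "0 \<le> g v v + 2 * c * g v z + c\<^sup>2 * g z z"
    by (simp add: symmetric_bilinear_expand[OF g sym, of 1 v c z, simplified])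
  then have "(g v v + 2 * c * g v z + c\<^sup>2 * g z z) * g z z \<le> 0"
    using neg by (simp add: mult_nonneg_nonpos)
  moreover have "(g v v + 2 * c * g v z + c\<^sup>2 * g z z) * g z z
     = g v v * g z z - (g v z)\<^sup>2 + (g v z + c * g z z)\<^sup>2"
    by (simp add: power2_eq_square algebra_simps)
  ultimately show ?thesis by (smt (verit) zero_le_power2)
qed

text \<open>
  The cone where the form is negative has one nappe on each side of the hyperplane; two vectors in
  the same nappe have a negative product.
\<close>
lemma same_side_nonpos:
  fixes g :: "'a::euclidean_space \<Rightarrow> 'a \<Rightarrow> real"
  assumes g: "bilinear g" and sym: "\<And>u v. g u v = g v u"
    and psd: "\<And>v. h \<bullet> v = 0 \<Longrightarrow> 0 \<le> g v v" and neg: "g z z < 0" "g w w < 0"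
    and side: "h \<bullet> z \<le> 0" "h \<bullet> w \<le> 0"
  shows "g z w \<le> 0"
proof -
  have h: "h \<bullet> z < 0" "h \<bullet> w < 0" using psd[of z] psd[of w] neg side by (auto simp: less_le)
  define c where "c = (h \<bullet> z) / (h \<bullet> w)"
  have c: "0 < c" using h by (simp add: c_def divide_neg_neg)
  have "h \<bullet> (1 *\<^sub>R z + (-c) *\<^sub>R w) = 0" using h by (simp add: inner_diff_right c_def)
  from psd[OF this] have "0 \<le> g z z - 2 * c * g z w + c\<^sup>2 * g w w"
    by (simp add: symmetric_bilinear_expand[OF g sym, of 1 z "-c" w, simplified])
  moreover have "c\<^sup>2 * g w w \<le> 0" using neg by (simp add: mult_nonneg_nonpos)
  ultimately have "c * g z w < 0" using neg by linarith
  then show ?thesis using c by (simp add: mult_less_0_iff)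
qed

section \<open>Negative eigenvalues of symmetric matrices\<close>

lemma linear_term_vanishes:
  fixes a c :: real
  assumes "\<And>t. 2 * t * a + t\<^sup>2 * c \<le> 0"
  shows "a = 0"
proof (rule ccontr)
  assume a: "a \<noteq> 0"
  define s where "s = 1 + \<bar>c\<bar>"
  define t where "t = a / s"
  have s: "0 < s" by (simp add: s_def)
  have "2 * t * a + t\<^sup>2 * c = a\<^sup>2 / s\<^sup>2 * (2 * s + c)"
    using s by (simp add: t_def power2_eq_square field_simps)
  moreover have "0 < 2 * s + c" by (simp add: s_def)
  ultimately have "0 < 2 * t * a + t\<^sup>2 * c" using a s by simp
  then show False using assms[of t] by simp
qed

lemma symmetric_matrix_inner_commute:
  fixes M :: "real^'m^'m"
  assumes "transpose M = M"
  shows "u \<bullet> (M *v v) = v \<bullet> (M *v u)"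
  by (metis dot_lmul_matrix inner_commute assms transpose_matrix_vector)

text \<open>
  A maximizer \<open>v\<close> of the Rayleigh quotient on the unit sphere of the subspace is an eigenvector: the
  first-order condition makes \<open>M v - d v\<close> orthogonal to the subspace, which contains it.
\<close>
lemma eigenvector_in_invariant_subspace:
  fixes M :: "real^'m^'m"
  assumes sym: "transpose M = M" and U: "subspace U" and inv: "\<And>v. v \<in> U \<Longrightarrow> M *v v \<in> U"
    and w: "w \<in> U" "w \<noteq> 0"
  obtains v d where "v \<in> U" "norm v = 1" "M *v v = d *\<^sub>R v"
proof -
  note symB = symmetric_matrix_inner_commute[OF sym]
  have "compact (U \<inter> sphere 0 1)" using closed_subspace[OF U] by (intro closed_Int_compact) auto
  moreover have "(1 / norm w) *\<^sub>R w \<in> U \<inter> sphere 0 1" using w U by (auto simp: subspace_scale)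
  moreover have "continuous_on (U \<inter> sphere 0 1) (\<lambda>v. v \<bullet> (M *v v))"
    by (intro continuous_intros)
  ultimately obtain v where v: "v \<in> U \<inter> sphere 0 1"
    and max: "\<And>u. u \<in> U \<inter> sphere 0 1 \<Longrightarrow> u \<bullet> (M *v u) \<le> v \<bullet> (M *v v)"
    using continuous_attains_sup[of "U \<inter> sphere 0 1" "\<lambda>v. v \<bullet> (M *v v)"] by blast
  define d where "d = v \<bullet> (M *v v)"
  have vv: "v \<bullet> v = 1" using v by (simp add: norm_eq_1)
  have le: "u \<bullet> (M *v u) \<le> d * (u \<bullet> u)" if "u \<in> U" for u
  proof (cases "u = 0")
    case False
    have "(1 / norm u) *\<^sub>R u \<in> U \<inter> sphere 0 1" using that False U by (auto simp: subspace_scale)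
    from max[OF this] have "u \<bullet> (M *v u) / (norm u * norm u) \<le> d"
      by (simp add: d_def matrix_vector_mult_scaleR)
    then show ?thesis using False by (simp add: field_simps norm_eq_sqrt_inner)
  qed simp
  have "(M *v v - d *\<^sub>R v) \<bullet> u = 0" if u: "u \<in> U" for u
  proof (rule linear_term_vanishes)
    fix t :: real
    have "v + t *\<^sub>R u \<in> U" using u v U by (auto intro: subspace_add subspace_scale)
    from le[OF this]
    moreover have "(v + t *\<^sub>R u) \<bullet> (M *v (v + t *\<^sub>R u))
        = d + 2 * t * (u \<bullet> (M *v v)) + t\<^sup>2 * (u \<bullet> (M *v u))"
      by (simp add: d_def matrix_vector_right_distrib matrix_vector_mult_scaleR inner_add_left
          inner_add_right symB[of v u] power2_eq_square distrib_left)
    moreover have "(v + t *\<^sub>R u) \<bullet> (v + t *\<^sub>R u) = 1 + 2 * t * (v \<bullet> u) + t\<^sup>2 * (u \<bullet> u)"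
      by (simp add: vv inner_add_left inner_add_right inner_commute[of u v] power2_eq_square distrib_left)
    ultimately have "d + 2 * t * (u \<bullet> (M *v v)) + t\<^sup>2 * (u \<bullet> (M *v u))
        \<le> d * (1 + 2 * t * (v \<bullet> u) + t\<^sup>2 * (u \<bullet> u))"
      by simp
    moreover have "(M *v v - d *\<^sub>R v) \<bullet> u = u \<bullet> (M *v v) - d * (v \<bullet> u)"
      by (simp add: inner_diff_left inner_commute[of "M *v v" u])
    ultimately show "2 * t * ((M *v v - d *\<^sub>R v) \<bullet> u) + t\<^sup>2 * (u \<bullet> (M *v u) - d * (u \<bullet> u)) \<le> 0"
      by (simp add: right_diff_distrib distrib_left mult_ac)
  qed
  moreover have "M *v v - d *\<^sub>R v \<in> U" using v U inv by (auto intro: subspace_diff subspace_scale)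
  ultimately have "M *v v = d *\<^sub>R v" using inner_eq_zero_iff by force
  with v show ?thesis by (intro that[of v d]) auto
qed

text \<open>
  A largest orthonormal set of eigenvectors is a basis, because its orthogonal complement is
  invariant and would otherwise contain another eigenvector.
\<close>
lemma orthonormal_eigenbasis:
  fixes M :: "real^'m^'m"
  assumes sym: "transpose M = M"
  obtains f :: "'m \<Rightarrow> real^'m" and d :: "'m \<Rightarrow> real"
  where "\<And>i j. f i \<bullet> f j = (if i = j then 1 else 0)" "\<And>i. M *v f i = d i *\<^sub>R f i"
proof -
  define P where "P = (\<lambda>E :: (real^'m) set. pairwise orthogonal E \<and>
    (\<forall>v\<in>E. norm v = 1 \<and> (\<exists>d. M *v v = d *\<^sub>R v)))"
  have indep: "independent E" if "P E" for E
    using that by (intro pairwise_orthogonal_independent) (auto simp: P_def)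
  have bound: "card E \<le> CARD('m)" if "P E" for E
    using independent_bound[OF indep[OF that]] by simp
  have "P {}" by (simp add: P_def)
  then obtain E where E: "P E" and max: "\<And>E'. P E' \<Longrightarrow> card E' \<le> card E"
    using ex_has_greatest_nat[of P "{}" card "CARD('m) + 1"] bound le_imp_less_Suc by auto
  have fin: "finite E" using indep[OF E] independent_bound by blast
  have card: "card E = CARD('m)"
  proof (rule ccontr)
    assume "card E \<noteq> CARD('m)"
    then have "dim (span E) < DIM(real^'m)"
      using bound[OF E] dim_eq_card_independent[OF indep[OF E]] by simp
    then obtain w where w: "w \<noteq> 0" "\<And>y. y \<in> span E \<Longrightarrow> orthogonal w y"
      using orthogonal_to_subspace_exists[of E] by auto
    define U where "U = {u. \<forall>e\<in>E. e \<bullet> u = 0}"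
    have U: "subspace U" unfolding subspace_def U_def by (auto simp: inner_add_right)
    have inv: "M *v v \<in> U" if "v \<in> U" for v
    proof -
      have "e \<bullet> (M *v v) = 0" if e: "e \<in> E" for e
      proof -
        obtain d where "M *v e = d *\<^sub>R e" using E e by (auto simp: P_def)
        moreover have "e \<bullet> (M *v v) = (M *v e) \<bullet> v"
          using symmetric_matrix_inner_commute[OF sym, of e v] by (simp add: inner_commute)
        ultimately show ?thesis using \<open>v \<in> U\<close> e by (simp add: U_def)
      qed
      then show ?thesis by (simp add: U_def)
    qed
    have "w \<in> U" using w(2) by (auto simp: U_def orthogonal_def inner_commute span_base)
    from eigenvector_in_invariant_subspace[OF sym U inv this w(1)]
    obtain v d where v: "v \<in> U" "norm v = 1" "M *v v = d *\<^sub>R v" by metis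
    have "v \<notin> E"
    proof
      assume "v \<in> E"
      then have "v \<bullet> v = 0" using v(1) by (auto simp: U_def)
      then show False using v(2) by simp
    qed
    moreover have "P (insert v E)"
      using E v unfolding P_def pairwise_insert by (auto simp: U_def orthogonal_def inner_commute)
    ultimately show False using max[of "insert v E"] fin by simp
  qed
  obtain f where f: "bij_betw f (UNIV :: 'm set) E"
    using finite_same_card_bij[of "UNIV :: 'm set" E] fin card by auto
  have fE: "f i \<in> E" for i using f by (auto simp: bij_betw_def)
  then have "\<forall>i. \<exists>d. M *v f i = d *\<^sub>R f i" using E by (auto simp: P_def)
  then obtain d where d: "\<And>i. M *v f i = d i *\<^sub>R f i" by metis
  show ?thesis
  proof (rule that[OF _ d])
    fix i j
    show "f i \<bullet> f j = (if i = j then 1 else 0)"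
    proof (cases "i = j")
      case True then show ?thesis using E fE[of i] by (auto simp: P_def norm_eq_1)
    next
      case False
      then have "f i \<noteq> f j" using f by (auto simp: bij_betw_def inj_def)
      then show ?thesis using E fE[of i] fE[of j] False
        by (auto simp: P_def pairwise_def orthogonal_def)
    qed
  qed
qed

lemma pCons_0_sum: "(\<Sum>k\<in>A. [:f k:]) = [:\<Sum>k\<in>A. f k:]"
  by (induction A rule: infinite_finite_induct) auto

text \<open>
  With the eigenvectors as the columns of a matrix of constant polynomials, \<open>X I - M\<close> is conjugate
  to a diagonal matrix over the polynomial ring.
\<close>
lemma charpoly_of_eigenbasis:
  fixes M :: "real^'m^'m" and f :: "'m \<Rightarrow> real^'m"
  assumes on: "\<And>i j. f i \<bullet> f j = (if i = j then 1 else 0)" and ev: "\<And>i. M *v f i = d i *\<^sub>R f i"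
  shows "charpoly M = (\<Prod>i\<in>UNIV. [:- d i, 1:])"
proof -
  define P :: "real poly^'m^'m" where "P = (\<chi> i j. [:f j $ i:])"
  define X :: "real poly^'m^'m" where "X = (\<chi> i j. if i = j then [:- (M $ i $ j), 1:] else [:- (M $ i $ j):])"
  define D :: "real poly^'m^'m" where "D = (\<chi> i j. if i = j then [:- d i, 1:] else 0)"
  have "transpose P ** P = mat 1"
  proof -
    have "(transpose P ** P) $ i $ j = (mat 1 :: real poly^'m^'m) $ i $ j" for i j
    proof -
      have "(transpose P ** P) $ i $ j = [:f i \<bullet> f j:]"
        by (simp add: P_def transpose_def matrix_matrix_mult_def inner_vec_def pCons_0_sum mult.commute)
      then show ?thesis by (simp add: on mat_def pCons_one)
    qed
    then show ?thesis by (simp add: vec_eq_iff)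
  qed
  then have "det (transpose P) * det P = 1" by (metis det_mul det_I)
  then have P0: "det P \<noteq> 0" by auto
  have "X ** P = P ** D"
  proof -
    have "(X ** P) $ i $ j = (P ** D) $ i $ j" for i j
    proof -
      have X: "X $ i $ k = (if i = k then [:0,1:] else 0) - [:M $ i $ k:]" for k
        by (simp add: X_def)
      have "(M *v f j) $ i = d j * f j $ i" by (simp add: ev)
      then have "(\<Sum>k\<in>UNIV. [:M $ i $ k:] * [:f j $ k:]) = [:d j * f j $ i:]"
        by (simp add: matrix_vector_mult_def pCons_0_sum mult.commute)
      moreover have "(\<Sum>k\<in>UNIV. (if i = k then [:0,1:] else 0) * [:f j $ k:]) = [:0,1:] * [:f j $ i:]"
      proof -
        have "(\<Sum>k\<in>UNIV. (if i = k then [:0,1:] else 0) * [:f j $ k:])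
            = (\<Sum>k\<in>UNIV. if k = i then [:0,1:] * [:f j $ k:] else 0)"
          by (rule sum.cong) auto
        then show ?thesis by simp
      qed
      moreover have "(X ** P) $ i $ j = (\<Sum>k\<in>UNIV. ((if i = k then [:0,1:] else 0) - [:M $ i $ k:]) * [:f j $ k:])"
        by (simp add: matrix_matrix_mult_def X P_def)
      ultimately have "(X ** P) $ i $ j = [:0,1:] * [:f j $ i:] - [:d j * f j $ i:]"
        by (simp only: left_diff_distrib sum_subtractf)
      also have "\<dots> = (P ** D) $ i $ j"
        by (simp add: matrix_matrix_mult_def D_def P_def if_distrib[where f="\<lambda>x. _ * x"] cong: if_cong)
      finally show ?thesis .
    qed
    then show ?thesis by (simp add: vec_eq_iff)
  qed
  then have "det X * det P = det P * det D" by (metis det_mul)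
  then have "det X = det D" using P0 by (simp add: mult.commute)
  also have "det D = (\<Prod>i\<in>UNIV. [:- d i, 1:])"
    by (subst det_diagonal) (auto simp: D_def)
  finally show ?thesis by (simp add: charpoly_def X_def)
qed

text \<open>
  Two orthonormal eigenvectors with negative eigenvalues would span a plane on which the form is
  negative definite, and every plane meets the hyperplane \<open>h \<bullet> v = 0\<close> outside \<open>0\<close>.
\<close>
lemma num_negative_eigenvalues_le_1:
  fixes M :: "real^'m^'m"
  assumes sym: "transpose M = M"
    and psd: "\<And>v. h \<bullet> v = 0 \<Longrightarrow> 0 \<le> v \<bullet> (M *v v)"
  shows "num_negative_eigenvalues M \<le> 1"
proof -
  obtain f :: "'m \<Rightarrow> real^'m" and d where on: "\<And>i j. f i \<bullet> f j = (if i = j then 1 else 0)"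
    and ev: "\<And>i. M *v f i = d i *\<^sub>R f i"
    by (rule orthonormal_eigenbasis[OF sym]) blast
  have "proots (charpoly M) = (\<Sum>i\<in>UNIV. {#d i#})"
    by (simp add: charpoly_of_eigenbasis[OF on ev] proots_prod)
  then have "num_negative_eigenvalues M = size (filter_mset (\<lambda>t. t < 0) (image_mset d (mset_set UNIV)))"
    unfolding num_negative_eigenvalues_def by (simp add: sum_unfold_sum_mset)
  also have "\<dots> = card {i. d i < 0}"
    by (simp add: filter_mset_image_mset)
  also have "\<dots> \<le> 1"
  proof (rule ccontr)
    assume "\<not> card {i. d i < 0} \<le> 1"
    then have "\<not> (\<forall>i\<in>{i. d i < 0}. \<forall>j\<in>{i. d i < 0}. i = j)" by (subst card_le_Suc0_iff_eq[symmetric]) auto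
    then obtain i j where ij: "d i < 0" "d j < 0" "i \<noteq> j" by auto
    \<comment> \<open>A nontrivial combination of the two eigenvectors in the hyperplane.\<close>
    define a where "a = (if h \<bullet> f j = 0 then 0 else h \<bullet> f j)"
    define b where "b = (if h \<bullet> f j = 0 then 1 else - (h \<bullet> f i))"
    have ab: "a \<noteq> 0 \<or> b \<noteq> 0" by (auto simp: a_def b_def)
    have "h \<bullet> (a *\<^sub>R f i + b *\<^sub>R f j) = 0"
      by (simp add: inner_add_right a_def b_def)
    then have "0 \<le> (a *\<^sub>R f i + b *\<^sub>R f j) \<bullet> (M *v (a *\<^sub>R f i + b *\<^sub>R f j))" by (rule psd)
    also have "\<dots> = a\<^sup>2 * d i + b\<^sup>2 * d j"
      using ij(3) by (simp add: matrix_vector_right_distrib matrix_vector_mult_scaleR ev inner_add_left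
        inner_add_right on power2_eq_square)
    also have "\<dots> < 0" using ab ij
      by (smt (verit) mult_nonneg_nonpos mult_pos_neg zero_le_power2 zero_less_power2)
    finally show False by simp
  qed
  finally show ?thesis .
qed

section \<open>A closed cone of valid aggregations\<close>

text \<open>
  Conditions for a valid aggregation in which \<open>\<mu>\<close> enters polynomially and through weak inequalities
  only, so that the set is visibly a closed cone. The second condition puts \<open>Z\<close> into a single nappe
  of the negative cone. The third one is the reverse Cauchy-Schwarz inequality, which expresses that
  the form has at most one negative eigenvalue when it is negative on some \<open>z \<in> Z\<close>.
\<close>
definition admissible_multipliers :: "('a::euclidean_space \<Rightarrow> 'a \<Rightarrow> real^3) \<Rightarrow> 'a set \<Rightarrow> (real^3) set" where
  "admissible_multipliers B Z = {\<mu>. (\<forall>i. 0 \<le> \<mu> $ i) \<and>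
     (\<forall>z\<in>Z. \<forall>w\<in>Z. \<mu> \<bullet> B z w \<le> 0) \<and>
     (\<forall>z\<in>Z. \<forall>v. (\<mu> \<bullet> B v v) * (\<mu> \<bullet> B z z) \<le> (\<mu> \<bullet> B v z)\<^sup>2)}"

lemma closed_admissible_multipliers: "closed (admissible_multipliers B Z)"
  unfolding admissible_multipliers_def Ball_def
  by (intro closed_Collect_conj closed_Collect_all closed_Collect_imp closed_Collect_le open_Collect_const
      continuous_intros)

lemma admissible_multipliers_scale:
  assumes "\<mu> \<in> admissible_multipliers B Z" "0 < s"
  shows "s *\<^sub>R \<mu> \<in> admissible_multipliers B Z"
proof -
  have "((s *\<^sub>R \<mu>) \<bullet> B v v) * ((s *\<^sub>R \<mu>) \<bullet> B z z) \<le> ((s *\<^sub>R \<mu>) \<bullet> B v z)\<^sup>2" if "z \<in> Z" for v z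
  proof -
    have "(\<mu> \<bullet> B v v) * (\<mu> \<bullet> B z z) \<le> (\<mu> \<bullet> B v z)\<^sup>2"
      using assms(1) that by (simp add: admissible_multipliers_def)
    then have "s\<^sup>2 * ((\<mu> \<bullet> B v v) * (\<mu> \<bullet> B z z)) \<le> s\<^sup>2 * (\<mu> \<bullet> B v z)\<^sup>2"
      by (intro mult_left_mono) auto
    then show ?thesis by (simp add: power2_eq_square mult_ac)
  qed
  then show ?thesis using assms
    by (auto simp: admissible_multipliers_def mult_nonneg_nonpos)
qed

section \<open>Homogeneous coordinates\<close>

definition homogenize :: "real^'n \<Rightarrow> real^('n option)" where
  "homogenize x = (\<chi> k. case k of Some j \<Rightarrow> x $ j | None \<Rightarrow> 1)"

lemma sum_option: "(\<Sum>k\<in>UNIV. f k) = f None + (\<Sum>j\<in>UNIV. f (Some j))"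
  for f :: "'n::finite option \<Rightarrow> 'b::comm_monoid_add"
  by (simp add: UNIV_option_conv sum.reindex)

lemma inner_homogenize: "h \<bullet> homogenize x = (\<chi> j. h $ Some j) \<bullet> x + h $ None"
  by (simp add: inner_vec_def sum_option homogenize_def)

text \<open>
  The three symmetric bilinear forms are kept as one vector-valued bilinear map, so that an
  aggregation is the inner product with its multiplier.
\<close>
definition quadratic_forms ::
  "(3 \<Rightarrow> real^'n^'n) \<Rightarrow> (3 \<Rightarrow> real^'n) \<Rightarrow> (3 \<Rightarrow> real)
    \<Rightarrow> real^('n option) \<Rightarrow> real^('n option) \<Rightarrow> real^3" where
  "quadratic_forms A b c u v = (\<chi> i. u \<bullet> (quadratic_matrix (A i) (b i) (c i) *v v))"

lemma bilinear_quadratic_forms: "bilinear (quadratic_forms A b c)"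
  unfolding bilinear_def quadratic_forms_def
  by (intro conjI allI linearI)
    (simp_all add: vec_eq_iff inner_add_left matrix_vector_right_distrib
      inner_add_right matrix_vector_mult_scaleR)

lemma transpose_quadratic_matrix:
  assumes "transpose M = M"
  shows "transpose (quadratic_matrix M d e) = quadratic_matrix M d e"
proof -
  have "M $ i $ j = M $ j $ i" for i j
    using arg_cong[OF assms, of "\<lambda>X. X $ j $ i"] by (simp add: transpose_def)
  then show ?thesis
    by (simp add: vec_eq_iff transpose_def quadratic_matrix_def split: option.split)
qed

lemma quadratic_forms_commute:
  assumes "\<And>i. transpose (A i) = A i"
  shows "quadratic_forms A b c u v = quadratic_forms A b c v u"
proof -
  have "u \<bullet> (quadratic_matrix (A i) (b i) (c i) *v v) = v \<bullet> (quadratic_matrix (A i) (b i) (c i) *v u)" for i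
    by (intro symmetric_matrix_inner_commute transpose_quadratic_matrix assms)
  then show ?thesis by (simp add: quadratic_forms_def)
qed

lemma quadratic_forms_homogenize:
  "quadratic_forms A b c (homogenize x) (homogenize x) $ i = quadratic_fun (A i) (b i) (c i) x"
proof -
  have "(\<chi> j. (quadratic_matrix (A i) (b i) (c i) *v homogenize x) $ Some j) = A i *v x + b i"
    by (simp add: vec_eq_iff matrix_vector_mult_def sum_option homogenize_def quadratic_matrix_def)
  moreover have "(quadratic_matrix (A i) (b i) (c i) *v homogenize x) $ None = b i \<bullet> x + c i"
    by (simp add: matrix_vector_mult_def sum_option homogenize_def quadratic_matrix_def inner_vec_def)
  ultimately show ?thesis
    using inner_homogenize[of "quadratic_matrix (A i) (b i) (c i) *v homogenize x" x]
    by (simp add: quadratic_forms_def quadratic_fun_def inner_commute inner_add_right)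
qed

lemma inner_quadratic_forms: "\<mu> \<bullet> quadratic_forms A b c u v = u \<bullet> (aggregated_matrix A b c \<mu> *v v)"
  by (simp add: aggregated_matrix_def quadratic_forms_def inner_vec_def[of \<mu>] sum_3
     matrix_vector_mult_add_rdistrib scaleR_matrix_vector_assoc[symmetric] inner_add_right)

lemma transpose_aggregated_matrix:
  assumes "\<And>i. transpose (A i) = A i"
  shows "transpose (aggregated_matrix A b c \<mu>) = aggregated_matrix A b c \<mu>"
proof -
  have "quadratic_matrix (A l) (b l) (c l) $ i $ j = quadratic_matrix (A l) (b l) (c l) $ j $ i" for l i j
    using arg_cong[OF transpose_quadratic_matrix[OF assms], of "\<lambda>X. X $ j $ i" l "b l" "c l"]
    by (simp add: transpose_def)
  then show ?thesis
    by (simp add: vec_eq_iff transpose_def aggregated_matrix_def)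
qed

lemma aggregated_set_iff:
  "x \<in> aggregated_set A b c \<mu> \<longleftrightarrow> \<mu> \<bullet> quadratic_forms A b c (homogenize x) (homogenize x) < 0"
  by (simp add: aggregated_set_def inner_vec_def quadratic_forms_homogenize)

lemma solution_set_iff:
  "x \<in> solution_set A b c \<longleftrightarrow> (\<forall>i. quadratic_forms A b c (homogenize x) (homogenize x) $ i < 0)"
  by (simp add: solution_set_def quadratic_forms_homogenize)

lemma inner_neg:
  fixes \<mu> u :: "real^'k"
  assumes "\<And>i. 0 \<le> \<mu> $ i" "\<mu> \<noteq> 0" "\<And>i. u $ i < 0"
  shows "\<mu> \<bullet> u < 0"
proof -
  obtain i where "\<mu> $ i \<noteq> 0" using assms(2) by (auto simp: vec_eq_iff)
  then have "0 < \<mu> $ i" using assms(1)[of i] by simp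
  then have "0 < (\<Sum>j\<in>UNIV. \<mu> $ j * - u $ j)"
    using assms(1) assms(3)
    by (intro sum_pos2[of _ i]) (auto simp: mult_nonneg_nonpos less_imp_le mult_pos_neg)
  then show ?thesis by (simp add: inner_vec_def sum_negf)
qed

lemma convex_linear_homogenize: "convex {x. h \<bullet> homogenize x < 0}"
proof -
  have "{x. h \<bullet> homogenize x < 0} = {x. (\<chi> j. h $ Some j) \<bullet> x < - (h $ None)}"
    by (auto simp: inner_homogenize)
  then show ?thesis by (simp add: convex_halfspace_lt)
qed

section \<open>The convex hull as an intersection of aggregations\<close>

text \<open>
  On pairs of solutions the product is even negative, because the reverse Cauchy-Schwarz inequality
  keeps it away from \<open>0\<close>. For a fixed argument this is an affine inequality in the other one, so
  it passes to the convex hull in each argument separately, and the diagonal gives the inclusion in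
  the aggregated set. The reverse Cauchy-Schwarz inequality at a solution says that the form is
  nonnegative on the hyperplane orthogonal to it.
\<close>
lemma admissible_imp_good:
  assumes symA: "\<And>i. transpose (A i) = A i" and ne: "solution_set A b c \<noteq> {}"
    and \<mu>: "\<mu> \<in> admissible_multipliers (quadratic_forms A b c) (homogenize ` solution_set A b c)" "\<mu> \<noteq> 0"
  shows "\<mu> \<in> good_aggregations A b c"
proof -
  define M where "M = aggregated_matrix A b c \<mu>"
  define S where "S = solution_set A b c"
  have form: "\<mu> \<bullet> quadratic_forms A b c u v = u \<bullet> (M *v v)" for u v
    by (simp add: M_def inner_quadratic_forms)
  have symM: "u \<bullet> (M *v v) = (M *v u) \<bullet> v" for u v
    using symmetric_matrix_inner_commute[OF transpose_aggregated_matrix[OF symA]] unfolding M_def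
    by (simp add: inner_commute)
  have nonneg: "\<And>i. 0 \<le> \<mu> $ i"
    and pair: "\<And>x y. x \<in> S \<Longrightarrow> y \<in> S \<Longrightarrow> homogenize x \<bullet> (M *v homogenize y) \<le> 0"
    and rcs: "\<And>x v. x \<in> S \<Longrightarrow> (v \<bullet> (M *v v)) * (homogenize x \<bullet> (M *v homogenize x)) \<le> (v \<bullet> (M *v homogenize x))\<^sup>2"
    using \<mu>(1) by (auto simp: admissible_multipliers_def form S_def)
  have neg: "homogenize x \<bullet> (M *v homogenize x) < 0" if "x \<in> S" for x
    using inner_neg[OF nonneg \<mu>(2)] that by (simp add: S_def solution_set_iff form[symmetric])
  have pair_neg: "(M *v homogenize x) \<bullet> homogenize y < 0" if "x \<in> S" "y \<in> S" for x y
  proof -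
    have "0 < (homogenize x \<bullet> (M *v homogenize x)) * (homogenize y \<bullet> (M *v homogenize y))"
      using neg that by (simp add: mult_neg_neg)
    also have "\<dots> \<le> (homogenize x \<bullet> (M *v homogenize y))\<^sup>2" by (rule rcs[OF that(2)])
    finally have "homogenize x \<bullet> (M *v homogenize y) \<noteq> 0" by auto
    then show ?thesis using pair[OF that] symM[of "homogenize x" "homogenize y"] by simp
  qed
  have hull1: "(M *v homogenize x) \<bullet> homogenize y < 0" if "x \<in> S" "y \<in> convex hull S" for x y
  proof -
    have "convex hull S \<subseteq> {y. (M *v homogenize x) \<bullet> homogenize y < 0}"
      using pair_neg that(1) by (intro hull_minimal convex_linear_homogenize) auto
    then show ?thesis using that(2) by auto
  qed
  have hull2: "(M *v homogenize y) \<bullet> homogenize x < 0" if "x \<in> convex hull S" "y \<in> convex hull S" for x y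
  proof -
    have "(M *v homogenize y) \<bullet> homogenize x < 0" if "x \<in> S" for x
      using hull1[OF that \<open>y \<in> convex hull S\<close>] symM[of "homogenize y" "homogenize x"]
      by (simp add: inner_commute)
    then have "convex hull S \<subseteq> {x. (M *v homogenize y) \<bullet> homogenize x < 0}"
      by (intro hull_minimal convex_linear_homogenize) auto
    then show ?thesis using that(1) by auto
  qed
  have "convex hull S \<subseteq> aggregated_set A b c \<mu>"
    using hull2 by (auto simp: aggregated_set_iff form inner_commute)
  moreover have "num_negative_eigenvalues M \<le> 1"
  proof -
    obtain x where x: "x \<in> S" using ne by (auto simp: S_def)
    show ?thesis
    proof (rule num_negative_eigenvalues_le_1[where h = "M *v homogenize x"])
      show "transpose M = M" unfolding M_def by (rule transpose_aggregated_matrix[OF symA])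
      fix v assume "(M *v homogenize x) \<bullet> v = 0"
      then have "(v \<bullet> (M *v v)) * (homogenize x \<bullet> (M *v homogenize x)) \<le> 0"
        using rcs[OF x, of v] by (simp add: inner_commute)
      then show "0 \<le> v \<bullet> (M *v v)" using neg[OF x] by (simp add: mult_le_0_iff)
    qed
  qed
  ultimately show ?thesis using nonneg \<mu>(2) by (simp add: good_aggregations_def M_def S_def)
qed

text \<open>
  A point \<open>v\<close> of the hyperplane where all forms are negative can be perturbed towards
  \<open>homogenize e\<close>. The result has a positive last coordinate, hence represents a solution, but lies
  on the wrong side. The perturbation also takes care of points at infinity, where the last
  coordinate of \<open>v\<close> is \<open>0\<close>.
\<close>
lemma no_negative_on_supporting_hyperplane:
  fixes A :: "3 \<Rightarrow> real^'n^'n"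
  assumes side: "\<And>x. x \<in> solution_set A b c \<Longrightarrow> h \<bullet> homogenize x \<le> 0"
    and e: "0 < h \<bullet> homogenize e" and v: "h \<bullet> v = 0"
  shows "\<exists>i. 0 \<le> quadratic_forms A b c v v $ i"
proof (rule ccontr)
  assume "\<not> ?thesis"
  then have neg: "\<And>i. quadratic_forms A b c v v $ i < 0" by (simp add: not_le)
  note bil = bilinear_quadratic_forms[of A b c]
  \<comment> \<open>Forms are even, so the last coordinate may be assumed to be nonnegative.\<close>
  define w where "w = (if v $ None < 0 then - v else v)"
  have w: "0 \<le> w $ None" "h \<bullet> w = 0" "\<And>i. quadratic_forms A b c w w $ i < 0"
    using v neg by (auto simp: w_def bilinear_lneg[OF bil] bilinear_rneg[OF bil])
  define q where "q = (\<lambda>t::real. quadratic_forms A b c (w + t *\<^sub>R homogenize e) (w + t *\<^sub>R homogenize e))"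
  have "continuous_on UNIV q" unfolding q_def
    by (intro bilinear_continuous_on_compose[OF _ _ bil] continuous_intros)
  then have "(q \<longlongrightarrow> q 0) (at_right 0)"
    by (metis continuous_on_def tendsto_within_subset subset_UNIV UNIV_I)
  then have "\<forall>\<^sub>F t in at_right 0. q t $ i < 0" for i
    using w(3)[of i] by (intro order_tendstoD(2)[OF tendsto_vec_nth, of q "q 0"]) (simp_all add: q_def)
  then have "\<forall>\<^sub>F t in at_right 0. \<forall>i. q t $ i < 0" by (rule eventually_all_finite)
  moreover have "\<forall>\<^sub>F t in at_right (0::real). 0 < t" by (rule eventually_at_right_less)
  ultimately have "\<forall>\<^sub>F t in at_right 0. 0 < t \<and> (\<forall>i. q t $ i < 0)"
    by (rule eventually_elim2) simp
  then obtain t where t: "0 < t" "\<And>i. q t $ i < 0"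
    using eventually_happens'[of "at_right (0::real)"] trivial_limit_at_right_real by blast
  define u where "u = w + t *\<^sub>R homogenize e"
  define \<tau> where "\<tau> = u $ None"
  define x where "x = (\<chi> j. u $ Some j / \<tau>)"
  have \<tau>: "0 < \<tau>" using w(1) t(1) by (simp add: \<tau>_def u_def homogenize_def)
  have u: "u = \<tau> *\<^sub>R homogenize x"
    using \<tau> by (auto simp: vec_eq_iff homogenize_def x_def \<tau>_def split: option.split)
  have "quadratic_forms A b c (homogenize x) (homogenize x) $ i < 0" for i
  proof -
    have "q t $ i = \<tau> * (\<tau> * quadratic_forms A b c (homogenize x) (homogenize x) $ i)"
      unfolding q_def u_def[symmetric] u by (simp add: bilinear_lmul[OF bil] bilinear_rmul[OF bil])
    then show ?thesis using t(2)[of i] \<tau> by (simp add: mult_less_0_iff)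
  qed
  then have "h \<bullet> homogenize x \<le> 0" by (intro side) (simp add: solution_set_iff)
  moreover have "\<tau> * (h \<bullet> homogenize x) = t * (h \<bullet> homogenize e)"
    using w(2) arg_cong[OF u, of "\<lambda>z. h \<bullet> z"] by (simp add: u_def inner_add_right)
  ultimately show False using \<tau> t(1) e
    by (metis linorder_not_le mult_nonneg_nonpos2 mult.commute mult_pos_pos less_imp_le)
qed

lemma separating_facet_multiplier:
  fixes A :: "3 \<Rightarrow> real^'n^'n"
  assumes n: "CARD('n) \<ge> 3" and symA: "\<And>i. transpose (A i) = A i"
    and pd: "positive_definite (aggregated_matrix A b c \<theta>)"
    and ne: "solution_set A b c \<noteq> {}" and y: "y \<notin> convex hull solution_set A b c"
  obtains \<mu> i where "\<mu> \<in> admissible_multipliers (quadratic_forms A b c) (homogenize ` solution_set A b c)"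
    "\<mu> \<noteq> 0" "\<mu> $ i = 0" "y \<notin> aggregated_set A b c \<mu>"
proof -
  define S where "S = solution_set A b c"
  define B where "B = quadratic_forms A b c"
  note bil = bilinear_quadratic_forms[of A b c, folded B_def]
  have sym: "B u v = B v u" for u v unfolding B_def by (rule quadratic_forms_commute[OF symA])
  have pos: "0 < \<theta> \<bullet> B v v" if "v \<noteq> 0" for v
    using pd that by (simp add: positive_definite_def inner_quadratic_forms B_def)
  have "convex hull S \<noteq> {}" using ne by (simp add: S_def)
  then obtain a \<beta> where a: "a \<noteq> 0" "a \<bullet> y \<ge> \<beta>" "\<And>x. x \<in> convex hull S \<Longrightarrow> a \<bullet> x \<le> \<beta>"
    using separating_hyperplane_sets[of "convex hull S" "{y}"] y by (auto simp: S_def)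
  \<comment> \<open>The normal of the linear hyperplane spanned by the points \<open>homogenize x\<close> with \<open>a \<bullet> x = a \<bullet> y\<close>.\<close>
  define h where "h = (\<chi> k. case k of Some j \<Rightarrow> a $ j | None \<Rightarrow> - (a \<bullet> y))"
  have h: "h \<bullet> homogenize x = a \<bullet> x - a \<bullet> y" for x
    by (simp add: inner_homogenize h_def)
  have side: "h \<bullet> homogenize x \<le> 0" if "x \<in> S" for x
    using a(2,3) that hull_inc[of x S] by (force simp: h)
  define U where "U = {v. h \<bullet> v = 0}"
  have "h \<noteq> 0"
  proof
    assume "h = 0"
    then have "a $ j = 0" for j unfolding h_def vec_eq_iff by (metis option.simps(5) vec_lambda_beta zero_index)
    then show False using a(1) by (simp add: vec_eq_iff)
  qed
  then have dimU: "3 \<le> dim U" using n by (simp add: U_def dim_hyperplane card_UNIV_option)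
  have subU: "subspace U" unfolding U_def by (rule subspace_hyperplane)
  have no: "\<exists>i. 0 \<le> B v v $ i" if "v \<in> U" for v
    unfolding B_def
  proof (rule no_negative_on_supporting_hyperplane[where h = h and e = "y + a"])
    show "0 < h \<bullet> homogenize (y + a)" using a(1) by (simp add: h inner_add_right)
  qed (use that side in \<open>auto simp: U_def S_def\<close>)
  obtain x0 where x0: "x0 \<in> S" using ne by (auto simp: S_def)
  \<comment> \<open>All forms are negative at a solution, where the combination \<open>\<theta>\<close> is positive.\<close>
  have "\<exists>i. \<theta> $ i < 0"
  proof (rule ccontr)
    assume "\<not> ?thesis"
    then have \<theta>: "\<And>i. 0 \<le> \<theta> $ i" by (simp add: not_less)
    have "homogenize x0 $ None \<noteq> 0" by (simp add: homogenize_def)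
    then have "homogenize x0 \<noteq> 0" by (metis zero_index)
    from pos[OF this] have p: "0 < \<theta> \<bullet> B (homogenize x0) (homogenize x0)" .
    then have "\<theta> \<noteq> 0" by auto
    from inner_neg[OF \<theta> this, of "B (homogenize x0) (homogenize x0)"] p x0
    show False by (simp add: S_def solution_set_iff B_def)
  qed
  then obtain i0 where i0: "\<theta> $ i0 < 0" by blast
  obtain \<mu> i where \<mu>: "\<And>i. 0 \<le> \<mu> $ i" "\<mu> \<noteq> 0" "\<mu> $ i = 0" "\<And>v. v \<in> U \<Longrightarrow> 0 \<le> \<mu> \<bullet> B v v"
    using facet_multiplier[OF bil sym subU dimU pos no i0] by blast
  note bil\<mu> = bilinear_inner_right[OF bil, of \<mu>]
  have sym\<mu>: "\<mu> \<bullet> B u v = \<mu> \<bullet> B v u" for u v by (simp add: sym)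
  have psd: "0 \<le> \<mu> \<bullet> B v v" if "h \<bullet> v = 0" for v using \<mu>(4) that by (simp add: U_def)
  have neg: "\<mu> \<bullet> B (homogenize x) (homogenize x) < 0" if "x \<in> S" for x
    using inner_neg[OF \<mu>(1,2)] that by (simp add: S_def solution_set_iff B_def)
  have "\<mu> \<in> admissible_multipliers B (homogenize ` S)"
    unfolding admissible_multipliers_def
    using \<mu>(1) same_side_nonpos[OF bil\<mu> sym\<mu> psd neg neg side side]
      reverse_cauchy_schwarz[OF bil\<mu> sym\<mu> psd neg] by auto
  moreover have "y \<notin> aggregated_set A b c \<mu>"
    using psd[of "homogenize y"] by (simp add: h aggregated_set_iff B_def)
  ultimately show ?thesis using \<mu>(2,3) that unfolding B_def S_def by blast
qed

theorem corollary2p20: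
  fixes A :: "3 \<Rightarrow> real^'n^'n" and b :: "3 \<Rightarrow> real^'n" and c :: "3 \<Rightarrow> real"
  assumes "CARD('n) \<ge> 3"
    and "\<And>i. transpose (A i) = A i"
    and "\<exists>\<theta> :: real^3. positive_definite (aggregated_matrix A b c \<theta>)"
    and "solution_set A b c \<noteq> {}"
    and "convex hull (solution_set A b c) \<noteq> UNIV"
  shows "\<exists>\<Omega>'. \<Omega>' \<subseteq> good_aggregations A b c \<and> finite \<Omega>' \<and> card \<Omega>' \<le> 6
           \<and> convex hull (solution_set A b c) = (\<Inter>\<mu>\<in>\<Omega>'. aggregated_set A b c \<mu>)"
proof -
  obtain \<theta> :: "real^3" where \<theta>: "positive_definite (aggregated_matrix A b c \<theta>)" using assms(3) by blast
  define C where "C = admissible_multipliers (quadratic_forms A b c) (homogenize ` solution_set A b c)"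
  have "\<exists>E. finite E \<and> card E \<le> 2 \<and> E \<subseteq> C - {0} \<and>
    (\<forall>\<mu> w. \<mu> \<in> C \<longrightarrow> \<mu> \<noteq> 0 \<longrightarrow> \<mu> $ i = 0 \<longrightarrow> 0 \<le> \<mu> \<bullet> w \<longrightarrow> (\<exists>\<nu>\<in>E. 0 \<le> \<nu> \<bullet> w))" for i
  proof (rule facet_extreme_rays[of C i])
    show "closed C" unfolding C_def by (rule closed_admissible_multipliers)
    show "s *\<^sub>R \<mu> \<in> C" if "\<mu> \<in> C" "0 < s" for \<mu> s
      using that unfolding C_def by (rule admissible_multipliers_scale)
    show "0 \<le> \<mu> $ j" if "\<mu> \<in> C" for \<mu> j using that by (simp add: C_def admissible_multipliers_def)
  qed blast
  then obtain E where E: "\<And>i. finite (E i)" "\<And>i. card (E i) \<le> 2" "\<And>i. E i \<subseteq> C - {0}"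
    "\<And>i \<mu> w. \<mu> \<in> C \<Longrightarrow> \<mu> \<noteq> 0 \<Longrightarrow> \<mu> $ i = 0 \<Longrightarrow> 0 \<le> \<mu> \<bullet> w \<Longrightarrow> \<exists>\<nu>\<in>E i. 0 \<le> \<nu> \<bullet> w"
    by metis
  define \<Omega>' where "\<Omega>' = (\<Union>i. E i)"
  have good: "\<Omega>' \<subseteq> good_aggregations A b c"
    using E(3) admissible_imp_good[OF assms(2,4)] unfolding \<Omega>'_def C_def by blast
  have "card \<Omega>' \<le> (\<Sum>i\<in>UNIV. card (E i))" unfolding \<Omega>'_def by (rule card_UN_le) simp
  also have "\<dots> \<le> (\<Sum>i\<in>(UNIV :: 3 set). 2)" by (intro sum_mono E(2))
  finally have card: "card \<Omega>' \<le> 6" by simp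
  have "y \<in> convex hull (solution_set A b c)" if y: "y \<in> (\<Inter>\<mu>\<in>\<Omega>'. aggregated_set A b c \<mu>)" for y
  proof (rule ccontr)
    assume "y \<notin> convex hull (solution_set A b c)"
    then obtain \<mu> i where \<mu>: "\<mu> \<in> C" "\<mu> \<noteq> 0" "\<mu> $ i = 0" "y \<notin> aggregated_set A b c \<mu>"
      using separating_facet_multiplier[OF assms(1,2) \<theta> assms(4)] unfolding C_def by metis
    then obtain \<nu> where "\<nu> \<in> E i" "0 \<le> \<nu> \<bullet> quadratic_forms A b c (homogenize y) (homogenize y)"
      using E(4)[OF \<mu>(1-3)] by (auto simp: aggregated_set_iff not_less)
    then show False using y by (force simp: \<Omega>'_def aggregated_set_iff)
  qed
  moreover have "convex hull (solution_set A b c) \<subseteq> (\<Inter>\<mu>\<in>\<Omega>'. aggregated_set A b c \<mu>)"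
    using good by (auto simp: good_aggregations_def)
  ultimately show ?thesis using good card E(1) by (intro exI[of _ \<Omega>']) (auto simp: \<Omega>'_def)
qed

end
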